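(* Let $X$ and $Y$ be disjoint posets and let $R\subseteq X\times Y$. Define the relation $\preceq_0$ on $X\cup Y$ by $\preceq_0\;=\;{\leq_X}\cup{\leq_Y}\cup R$. The following are equivalent: (1) $(X,Y,R)$ is 0-coherent; (2) $\preceq_0$ is a 0-preorder for $(X,Y,R)$; (3) there exists a 0-preorder for $(X,Y,R)$. Moreover, the set of 0-preorders for $(X,Y,R)$ is closed under non-empty intersections and, if it is non-empty, has $\preceq_0$ as its smallest member.
   Context: A 0-preorder for $(X,Y,R)$ is a preorder (reflexive, transitive relation) $\preceq$ on $X\cup Y$ such that: (P1) for all $x\in X$, $y\in Y$: $x\preceq y\iff x\mathrel{R}y$; (P2) for all $x_1,x_2\in X$: $x_1\leq_X x_2\Rightarrow x_1\preceq x_2$; (P3) for all $y_1,y_2\in Y$: $y_1\leq_Y y_2\Rightarrow y_1\preceq y_2$. $(X,Y,R)$ is 0-coherent if (C1) for all $x_1,x_2\in X$ and $y\in Y$, if $x_1\leq_X x_2$ and $x_2\mathrel{R}y$ then $x_1\mathrel{R}y$; and (C2) for all $y_1,y_2\in Y$ and $x\in X$, if $y_1\leq_Y y_2$ and $x\mathrel{R}y_1$ then $x\mathrel{R}y_2$. *)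

theory Defs
  imports Main
begin

text \<open>
  The posets are carrier sets \<open>X\<close>, \<open>Y\<close> inside one ambient type, with their orders \<open>leX\<close>, \<open>leY\<close>
  given as sets of pairs. Note that \<open>preorder_on A r\<close> and \<open>partial_order_on A r\<close> include
  \<open>r \<subseteq> A \<times> A\<close>.
\<close>

definition zero_preorder ::
  "'a set \<Rightarrow> 'a rel \<Rightarrow> 'a set \<Rightarrow> 'a rel \<Rightarrow> 'a rel \<Rightarrow> 'a rel \<Rightarrow> bool" where
  "zero_preorder X leX Y leY R P \<longleftrightarrow>
     preorder_on (X \<union> Y) P \<and>
     (\<forall>x\<in>X. \<forall>y\<in>Y. (x, y) \<in> P \<longleftrightarrow> (x, y) \<in> R) \<and>
     (\<forall>x1\<in>X. \<forall>x2\<in>X. (x1, x2) \<in> leX \<longrightarrow> (x1, x2) \<in> P) \<and>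
     (\<forall>y1\<in>Y. \<forall>y2\<in>Y. (y1, y2) \<in> leY \<longrightarrow> (y1, y2) \<in> P)"

definition zero_coherent ::
  "'a set \<Rightarrow> 'a rel \<Rightarrow> 'a set \<Rightarrow> 'a rel \<Rightarrow> 'a rel \<Rightarrow> bool" where
  "zero_coherent X leX Y leY R \<longleftrightarrow>
     (\<forall>x1\<in>X. \<forall>x2\<in>X. \<forall>y\<in>Y. (x1, x2) \<in> leX \<and> (x2, y) \<in> R \<longrightarrow> (x1, y) \<in> R) \<and>
     (\<forall>y1\<in>Y. \<forall>y2\<in>Y. \<forall>x\<in>X. (y1, y2) \<in> leY \<and> (x, y1) \<in> R \<longrightarrow> (x, y2) \<in> R)"

definition prec_zero :: "'a rel \<Rightarrow> 'a rel \<Rightarrow> 'a rel \<Rightarrow> 'a rel" where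
  "prec_zero leX leY R = leX \<union> leY \<union> R"

end

theory Submission
  imports Defs
begin

text \<open>A 0-preorder P agrees with R on X \<times> Y by (P1), so transitivity of P through a
  middle point of X or of Y is exactly what (C1) and (C2) ask of R. Conversely, these two conditions
  are all that \<open>prec_zero\<close> needs to be transitive, because X and Y are disjoint and R
  only leads from X to Y (\<open>zero_coherent_imp_zero_preorder_prec_zero\<close>). Each of the
  three pieces of \<open>prec_zero\<close> is forced into every 0-preorder, so it is the least one
  as soon as any exists.\<close>

lemma zero_preorder_imp_zero_coherent:
  assumes "zero_preorder X leX Y leY R P"
  shows "zero_coherent X leX Y leY R"
proof -
  have "trans P"
    using assms by (simp add: zero_preorder_def preorder_on_def)
  then show ?thesis
    using assms unfolding zero_preorder_def zero_coherent_def
    by (meson transD)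
qed

text \<open>(P2) puts \<open>leX\<close> into P, (P3) \<open>leY\<close>, and (P1) \<open>R\<close>;
  the carrier inclusions make these clauses apply to every pair.\<close>

lemma prec_zero_subset_zero_preorder:
  assumes "leX \<subseteq> X \<times> X" "leY \<subseteq> Y \<times> Y" "R \<subseteq> X \<times> Y"
    and "zero_preorder X leX Y leY R P"
  shows "prec_zero leX leY R \<subseteq> P"
  using assms unfolding zero_preorder_def prec_zero_def by blast

lemma zero_coherent_imp_zero_preorder_prec_zero:
  assumes X: "preorder_on X leX" and Y: "preorder_on Y leY"
    and disj: "X \<inter> Y = {}" and R: "R \<subseteq> X \<times> Y"
    and coh: "zero_coherent X leX Y leY R"
  shows "zero_preorder X leX Y leY R (prec_zero leX leY R)"
proof -
  have leX: "leX \<subseteq> X \<times> X" "refl_on X leX" "trans leX"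
    and leY: "leY \<subseteq> Y \<times> Y" "refl_on Y leY" "trans leY"
    using X Y by (auto simp: preorder_on_def)
  have "trans (prec_zero leX leY R)"
  proof (rule transI)
    fix a b c
    assume "(a, b) \<in> prec_zero leX leY R" "(b, c) \<in> prec_zero leX leY R"
    \<comment> \<open>The other five of the nine combinations would put b in both X and Y. The two
      mixed cases that remain are (C1) and (C2).\<close>
    then consider "(a, b) \<in> leX" "(b, c) \<in> leX" | "(a, b) \<in> leY" "(b, c) \<in> leY"
      | "(a, b) \<in> leX" "(b, c) \<in> R" | "(a, b) \<in> R" "(b, c) \<in> leY"
      using leX(1) leY(1) R disj unfolding prec_zero_def by blast
    then show "(a, c) \<in> prec_zero leX leY R"
    proof cases
      case 1
      then show ?thesis using leX(3) unfolding prec_zero_def by (blast dest: transD)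
    next
      case 2
      then show ?thesis using leY(3) unfolding prec_zero_def by (blast dest: transD)
    next
      case 3
      then show ?thesis using coh leX(1) R unfolding zero_coherent_def prec_zero_def by blast
    next
      case 4
      then show ?thesis using coh leY(1) R unfolding zero_coherent_def prec_zero_def by blast
    qed
  qed
  moreover have "refl_on (X \<union> Y) (prec_zero leX leY R)"
    using leX(2) leY(2) unfolding refl_on_def prec_zero_def by blast
  \<comment> \<open>For (P1), a pair in X \<times> Y lies in neither \<open>leX\<close> nor
    \<open>leY\<close> by disjointness, so it can only come from \<open>R\<close>.\<close>
  ultimately show ?thesis
    using leX(1) leY(1) R disj unfolding zero_preorder_def preorder_on_def prec_zero_def by blast
qed

text \<open>All conditions are checked member by member. Some member must exist to confine the
  intersection to X \<union> Y and to give the direction of (P1) from P to R: the empty intersection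
  is the universal relation.\<close>

lemma zero_preorder_Inter:
  assumes "\<P> \<noteq> {}" and "\<And>P. P \<in> \<P> \<Longrightarrow> zero_preorder X leX Y leY R P"
  shows "zero_preorder X leX Y leY R (\<Inter>\<P>)"
proof -
  have "\<Inter>\<P> \<subseteq> (X \<union> Y) \<times> (X \<union> Y)"
    using assms unfolding zero_preorder_def preorder_on_def by blast
  moreover have "refl_on (X \<union> Y) (\<Inter>\<P>)"
    using assms(2) unfolding zero_preorder_def preorder_on_def refl_on_def by blast
  \<comment> \<open>\<open>trans_INTER\<close> is about indexed families; here the family is indexed
    by itself through \<open>id\<close>.\<close>
  moreover have "trans (\<Inter>\<P>)"
    using assms(2) unfolding zero_preorder_def preorder_on_def by (blast intro: trans_INTER[of _ id, simplified])
  ultimately show ?thesis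
    using assms unfolding zero_preorder_def preorder_on_def by blast
qed

theorem theorem3p4:
  fixes X Y :: "'a set" and leX leY R :: "'a rel"
  assumes "partial_order_on X leX"
    and "partial_order_on Y leY"
    and "X \<inter> Y = {}"
    and "R \<subseteq> X \<times> Y"
  shows "(zero_coherent X leX Y leY R \<longleftrightarrow>
            zero_preorder X leX Y leY R (prec_zero leX leY R)) \<and>
         (zero_preorder X leX Y leY R (prec_zero leX leY R) \<longleftrightarrow>
            (\<exists>P. zero_preorder X leX Y leY R P)) \<and>
         (\<forall>\<P>. \<P> \<noteq> {} \<and> \<P> \<subseteq> {P. zero_preorder X leX Y leY R P} \<longrightarrow>
            \<Inter>\<P> \<in> {P. zero_preorder X leX Y leY R P}) \<and>
         ({P. zero_preorder X leX Y leY R P} \<noteq> {} \<longrightarrow>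
            prec_zero leX leY R \<in> {P. zero_preorder X leX Y leY R P} \<and>
            (\<forall>P \<in> {P. zero_preorder X leX Y leY R P}. prec_zero leX leY R \<subseteq> P))"
proof -
  have leX: "preorder_on X leX" "leX \<subseteq> X \<times> X" and leY: "preorder_on Y leY" "leY \<subseteq> Y \<times> Y"
    using assms(1,2) by (auto simp: partial_order_on_def preorder_on_def)
  have prec: "zero_preorder X leX Y leY R (prec_zero leX leY R)"
    if "zero_coherent X leX Y leY R"
    using zero_coherent_imp_zero_preorder_prec_zero[OF leX(1) leY(1) assms(3,4) that] .
  have least: "prec_zero leX leY R \<subseteq> P" if "zero_preorder X leX Y leY R P" for P
    using prec_zero_subset_zero_preorder[OF leX(2) leY(2) assms(4) that] .
  have Inter: "zero_preorder X leX Y leY R (\<Inter>\<P>)"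
    if "\<P> \<noteq> {}" "\<P> \<subseteq> {P. zero_preorder X leX Y leY R P}" for \<P>
    using that by (auto intro: zero_preorder_Inter)
  show ?thesis
    using prec least Inter zero_preorder_imp_zero_coherent[of X leX Y leY R]
    by (simp, blast)
qed

end
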